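(* Let $r\in\mathbb{Q}\cap\,]0,+\infty[$. (1) There exists a finite graph $\Gamma=(V,E)$ such that $r=\dfrac{|\mathrm{Aut}(\Gamma)|}{|V|}$. (2) There exists a finite graph $\Gamma=(V,E)$ such that $r=\dfrac{|\mathrm{Aut}(\Gamma)|}{|V|+|E|}$. Here $V$ and $E$ are the sets of vertices and edges of $\Gamma$, respectively, and $\mathrm{Aut}(\Gamma)$ is the group of graph automorphisms of $\Gamma$.
   Context: A graph is a pair $(V,E)$ with $V$ a set (vertices) and $E$ a set of 2-element subsets of $V$ (edges); thus graphs are undirected, without loops or multiple edges, and need not be connected. A graph homomorphism $(V_1,E_1)\to(V_2,E_2)$ is a map $f\colon V_1\to V_2$ such that $f(e)\in E_2$ for every $e\in E_1$; automorphisms are the invertible endomorphisms in the resulting category. *)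

theory Defs
  imports Complex_Main "HOL-Algebra.Coset" "HOL-Library.FuncSet"
begin

type_synonym 'v graph = "'v set \<times> 'v set set"

abbreviation verts :: "'v graph \<Rightarrow> 'v set"
  where "verts \<Gamma> \<equiv> fst \<Gamma>"

abbreviation edges :: "'v graph \<Rightarrow> 'v set set"
  where "edges \<Gamma> \<equiv> snd \<Gamma>"

definition is_graph :: "'v graph \<Rightarrow> bool"
  where "is_graph \<Gamma> \<longleftrightarrow> (\<forall>e\<in>edges \<Gamma>. e \<subseteq> verts \<Gamma> \<and> card e = 2)"

text \<open>
  Only the values on the vertices matter: homomorphisms are extensional functions
  (\<open>undefined\<close> off the vertex set), so that they can be counted.
\<close>

definition graph_hom :: "'v graph \<Rightarrow> 'w graph \<Rightarrow> ('v \<Rightarrow> 'w) set"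
  where "graph_hom \<Gamma> \<Delta> =
    {f \<in> verts \<Gamma> \<rightarrow>\<^sub>E verts \<Delta>. \<forall>e\<in>edges \<Gamma>. f ` e \<in> edges \<Delta>}"

definition graph_End :: "'v graph \<Rightarrow> ('v \<Rightarrow> 'v) monoid"
  where "graph_End \<Gamma> =
    \<lparr>carrier = graph_hom \<Gamma> \<Gamma>,
     mult = (\<lambda>g f. compose (verts \<Gamma>) g f),
     one = (\<lambda>x\<in>verts \<Gamma>. x)\<rparr>"

definition graph_Aut :: "'v graph \<Rightarrow> ('v \<Rightarrow> 'v) monoid"
  where "graph_Aut \<Gamma> = units_of (graph_End \<Gamma>)"

lemma monoid_graph_End:
  assumes "is_graph \<Gamma>"
  shows "monoid (graph_End \<Gamma>)"
proof -
  have im: "f ` e = g ` e" if "e \<in> edges \<Gamma>" "\<And>x. x \<in> verts \<Gamma> \<Longrightarrow> f x = g x"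
    for e and f g :: "'a \<Rightarrow> 'a"
    using assms that unfolding is_graph_def by (intro image_cong) auto
  have comp: "compose (verts \<Gamma>) g f \<in> graph_hom \<Gamma> \<Gamma>"
    if f: "f \<in> graph_hom \<Gamma> \<Gamma>" and g: "g \<in> graph_hom \<Gamma> \<Gamma>" for f g
  proof -
    have "compose (verts \<Gamma>) g f ` e \<in> edges \<Gamma>" if e: "e \<in> edges \<Gamma>" for e
    proof -
      have "compose (verts \<Gamma>) g f ` e = g ` f ` e"
        using im[OF e, of "compose (verts \<Gamma>) g f" "g \<circ> f"]
        by (simp add: compose_def image_comp)
      then show ?thesis using f g e by (simp add: graph_hom_def)
    qed
    then show ?thesis using f g
      by (auto simp: graph_hom_def compose_def PiE_iff extensional_def)
  qed
  have one: "(\<lambda>x\<in>verts \<Gamma>. x) \<in> graph_hom \<Gamma> \<Gamma>"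
    using im[where f = "\<lambda>x\<in>verts \<Gamma>. x" and g = "\<lambda>x. x"]
    by (auto simp: graph_hom_def)
  show ?thesis
  proof (rule monoidI, goal_cases)
    case (3 x y z)
    then show ?case
      by (auto simp: graph_End_def graph_hom_def compose_def fun_eq_iff PiE_iff)
  next
    case (4 x)
    then show ?case
      by (auto simp: graph_End_def graph_hom_def compose_def fun_eq_iff PiE_iff extensional_def)
  next
    case (5 x)
    then show ?case
      by (auto simp: graph_End_def graph_hom_def compose_def fun_eq_iff PiE_iff extensional_def)
  qed (use comp one in \<open>auto simp: graph_End_def\<close>)
qed

lemma group_graph_Aut: "is_graph \<Gamma> \<Longrightarrow> group (graph_Aut \<Gamma>)"
  unfolding graph_Aut_def by (intro monoid.units_group monoid_graph_End)

end

theory Submission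
  imports Defs "HOL-Combinatorics.Permutations"
begin

text \<open>
  Take a path on \<open>n \<ge> 2\<close> vertices together with \<open>m\<close> isolated vertices.  An automorphism permutes
  the isolated vertices arbitrarily and either fixes or reverses the path, so there are \<open>2 * m!\<close>
  automorphisms, a number that does not depend on \<open>n\<close> (\<open>order_graph_Aut_path_plus_isolated\<close>).
  On the other hand the graph has \<open>n + m\<close> vertices and \<open>n - 1\<close> edges, so that, \<open>m\<close> being fixed,
  \<open>|V|\<close> runs through all integers \<open>\<ge> m + 2\<close> and \<open>|V| + |E| = m + 2 * n - 1\<close> through all
  integers \<open>\<ge> m + 3\<close> of the parity of \<open>m - 1\<close>.

  Given \<open>r = a / b\<close>, it remains to pick \<open>m\<close> so that \<open>2 * m! / r\<close> is such an integer.
  It is an even integer as soon as \<open>m \<ge> a\<close>, which forces \<open>m\<close> to be odd for the second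
  part, and it is large enough because \<open>m!\<close> outgrows \<open>m\<close>.
\<close>

section \<open>Automorphisms as adjacency-preserving bijections\<close>

lemma graph_hom_edge:
  assumes "f \<in> graph_hom \<Gamma> \<Delta>" "{x, y} \<in> edges \<Gamma>"
  shows "{f x, f y} \<in> edges \<Delta>"
proof -
  have "f ` {x, y} \<in> edges \<Delta>" using assms unfolding graph_hom_def by blast
  then show ?thesis by simp
qed

lemma graph_homI:
  assumes "is_graph \<Gamma>" "f \<in> verts \<Gamma> \<rightarrow>\<^sub>E verts \<Delta>"
    and "\<And>x y. x \<in> verts \<Gamma> \<Longrightarrow> y \<in> verts \<Gamma> \<Longrightarrow> {x, y} \<in> edges \<Gamma> \<Longrightarrow> {f x, f y} \<in> edges \<Delta>"
  shows "f \<in> graph_hom \<Gamma> \<Delta>"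
proof -
  have "f ` e \<in> edges \<Delta>" if e: "e \<in> edges \<Gamma>" for e
  proof -
    from assms(1) e have "e \<subseteq> verts \<Gamma>" "card e = 2" by (auto simp: is_graph_def)
    then obtain x y where "e = {x, y}" by (auto simp: card_2_iff)
    with \<open>e \<subseteq> verts \<Gamma>\<close> e assms(3)[of x y] show ?thesis by simp
  qed
  with assms(2) show ?thesis by (simp add: graph_hom_def)
qed

text \<open>
  Invertibility in the endomorphism monoid demands that the inverse map preserve edges as well,
  which is why adjacency has to be reflected, not only preserved.
\<close>

lemma carrier_graph_Aut:
  assumes "is_graph \<Gamma>"
  shows "carrier (graph_Aut \<Gamma>) =
    {f \<in> extensional (verts \<Gamma>). bij_betw f (verts \<Gamma>) (verts \<Gamma>) \<and>
       (\<forall>x\<in>verts \<Gamma>. \<forall>y\<in>verts \<Gamma>. {f x, f y} \<in> edges \<Gamma> \<longleftrightarrow> {x, y} \<in> edges \<Gamma>)}"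
    (is "_ = ?A")
proof -
  let ?V = "verts \<Gamma>"
  have units: "carrier (graph_Aut \<Gamma>) = {f \<in> graph_hom \<Gamma> \<Gamma>. \<exists>g\<in>graph_hom \<Gamma> \<Gamma>.
      compose ?V g f = (\<lambda>x\<in>?V. x) \<and> compose ?V f g = (\<lambda>x\<in>?V. x)}"
    by (simp add: graph_Aut_def units_of_def Units_def graph_End_def)
  show ?thesis
  proof (intro equalityI subsetI)
    fix f assume "f \<in> carrier (graph_Aut \<Gamma>)"
    then obtain g where f: "f \<in> graph_hom \<Gamma> \<Gamma>" and g: "g \<in> graph_hom \<Gamma> \<Gamma>"
      and "compose ?V g f = (\<lambda>x\<in>?V. x)" "compose ?V f g = (\<lambda>x\<in>?V. x)"
      unfolding units by blast
    then have gf: "g (f x) = x" and fg: "f (g x) = x" if "x \<in> ?V" for x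
      using that by (metis compose_eq restrict_apply')+
    have fV: "f x \<in> ?V" and gV: "g x \<in> ?V" if "x \<in> ?V" for x
      using f g that by (auto simp: graph_hom_def)
    have "bij_betw f ?V ?V"
      by (rule bij_betw_byWitness[where f' = g]) (auto simp: gf fg fV gV)
    moreover have "{f x, f y} \<in> edges \<Gamma> \<longleftrightarrow> {x, y} \<in> edges \<Gamma>" if "x \<in> ?V" "y \<in> ?V" for x y
      using graph_hom_edge[OF f, of x y] graph_hom_edge[OF g, of "f x" "f y"] gf that by auto
    moreover have "f \<in> extensional ?V" using f by (auto simp: graph_hom_def PiE_def)
    ultimately show "f \<in> ?A" by blast
  next
    fix f assume fA: "f \<in> ?A"
    then have bij: "bij_betw f ?V ?V" by simp
    define g where "g = restrict (inv_into ?V f) ?V"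
    have g_bij: "bij_betw (inv_into ?V f) ?V ?V" using bij by (rule bij_betw_inv_into)
    have gV: "g x \<in> ?V" and fV: "f x \<in> ?V" and fg: "f (g x) = x" and gf: "g (f x) = x"
      if "x \<in> ?V" for x
      using that bij g_bij
      by (auto simp: g_def bij_betwE bij_betw_inv_into_left bij_betw_inv_into_right)
    have "f \<in> graph_hom \<Gamma> \<Gamma>"
      using fA fV by (intro graph_homI[OF assms]) (auto simp: PiE_def)
    moreover have "g \<in> graph_hom \<Gamma> \<Gamma>"
    proof (rule graph_homI[OF assms])
      show "g \<in> ?V \<rightarrow>\<^sub>E ?V" using gV by (auto simp: PiE_def g_def)
      show "{g x, g y} \<in> edges \<Gamma>" if "x \<in> ?V" "y \<in> ?V" "{x, y} \<in> edges \<Gamma>" for x y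
        using fA gV[OF that(1)] gV[OF that(2)] fg[OF that(1)] fg[OF that(2)] that(3) by fastforce
    qed
    moreover have "compose ?V g f = (\<lambda>x\<in>?V. x)" "compose ?V f g = (\<lambda>x\<in>?V. x)"
      by (auto simp: compose_def fg gf)
    ultimately show "f \<in> carrier (graph_Aut \<Gamma>)" unfolding units by blast
  qed
qed

section \<open>A path together with isolated vertices\<close>

definition path_plus_isolated :: "nat \<Rightarrow> nat \<Rightarrow> nat graph"
  where "path_plus_isolated n m = ({..<n + m}, (\<lambda>i. {i, Suc i}) ` {..<n - 1})"

lemma verts_path_plus_isolated [simp]: "verts (path_plus_isolated n m) = {..<n + m}"
  by (simp add: path_plus_isolated_def)

lemma edge_path_plus_isolated_iff:
  "{x, y} \<in> edges (path_plus_isolated n m) \<longleftrightarrow> x < n \<and> y < n \<and> (y = Suc x \<or> x = Suc y)"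
  by (auto simp: path_plus_isolated_def doubleton_eq_iff)

lemma is_graph_path_plus_isolated: "is_graph (path_plus_isolated n m)"
  by (auto simp: is_graph_def path_plus_isolated_def)

lemma card_edges_path_plus_isolated: "card (edges (path_plus_isolated n m)) = n - 1"
proof -
  have "inj_on (\<lambda>i. {i, Suc i}) {..<n - 1}"
    by (auto simp: inj_on_def doubleton_eq_iff)
  then show ?thesis by (simp add: path_plus_isolated_def card_image)
qed

text \<open>
  A walk along the path that never revisits a vertex cannot turn back, so its starting point
  and its first step determine it; at an end point the first step is forced too.
\<close>

lemma path_walk_from_0:
  fixes f :: "nat \<Rightarrow> nat"
  assumes "inj_on f {..<n}" "f 0 = 0"
    and step: "\<And>i. Suc i < n \<Longrightarrow> f (Suc i) = Suc (f i) \<or> f i = Suc (f (Suc i))"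
    and "i < n"
  shows "f i = i"
  using \<open>i < n\<close>
proof (induction i rule: less_induct)
  case (less i)
  show ?case
  proof (cases i)
    case 0
    with assms(2) show ?thesis by simp
  next
    case i: (Suc j)
    have fj: "f j = j" using less i by simp
    from step[of j] less.prems i fj consider "f i = i" | "j = Suc (f i)" by auto
    then show ?thesis
    proof cases
      case 2
      \<comment> \<open>Turning back would hit the vertex visited two steps earlier.\<close>
      then have "f (f i) = f i" using less i by simp
      moreover have "f i \<noteq> i" using 2 i by simp
      moreover have "f i < n" using 2 i less.prems by simp
      ultimately show ?thesis using assms(1) less.prems by (auto simp: inj_on_def)
    qed
  qed
qed

text \<open>
  These are all the candidates for automorphisms: \<open>b\<close> tells whether the path is reversed, and
  \<open>p\<close> moves the isolated vertices.
\<close>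

definition flip_and_permute :: "nat \<Rightarrow> nat \<Rightarrow> bool \<times> (nat \<Rightarrow> nat) \<Rightarrow> nat \<Rightarrow> nat"
  where "flip_and_permute n m = (\<lambda>(b, p). \<lambda>x\<in>{..<n + m}.
    if x < n then (if b then n - 1 - x else x) else p x)"

lemma flip_and_permute_in_Aut:
  assumes p: "p permutes {n..<n + m}"
  shows "flip_and_permute n m (b, p) \<in> carrier (graph_Aut (path_plus_isolated n m))"
proof -
  let ?f = "flip_and_permute n m (b, p)"
  have pV: "n \<le> p x" "p x < n + m" if "n \<le> x" "x < n + m" for x
    using permutes_in_image[OF p, of x] that by auto
  have "inj_on ?f {..<n + m}"
  proof (rule inj_onI)
    fix x y assume "x \<in> {..<n + m}" "y \<in> {..<n + m}" "?f x = ?f y"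
    then show "x = y"
      using pV[of x] pV[of y] injD[OF permutes_inj[OF p], of x y]
      by (cases "x < n"; cases "y < n"; cases b) (auto simp: flip_and_permute_def)
  qed
  moreover have "?f ` {..<n + m} \<subseteq> {..<n + m}"
    using pV by (auto simp: flip_and_permute_def)
  ultimately have "bij_betw ?f {..<n + m} {..<n + m}"
    by (simp add: bij_betw_def endo_inj_surj)
  moreover have "?f \<in> extensional {..<n + m}" by (simp add: flip_and_permute_def)
  moreover have "{?f x, ?f y} \<in> edges (path_plus_isolated n m) \<longleftrightarrow>
      {x, y} \<in> edges (path_plus_isolated n m)" if "x < n + m" "y < n + m" for x y
    using that pV[of x] pV[of y]
    by (cases "x < n"; cases "y < n"; cases b)
      (auto simp: edge_path_plus_isolated_iff flip_and_permute_def)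
  ultimately show ?thesis
    by (simp add: carrier_graph_Aut[OF is_graph_path_plus_isolated])
qed

text \<open>
  Having a neighbour singles out the path (this needs \<open>n \<ge> 2\<close>), and having a single neighbour
  singles out its two ends.  So \<open>0\<close> goes to an end, and \<open>path_walk_from_0\<close>, applied to the
  automorphism or to its composition with the reversal, determines the rest of the path.
\<close>

lemma graph_Aut_path_plus_isolated_cases:
  assumes n: "2 \<le> n" and f: "f \<in> carrier (graph_Aut (path_plus_isolated n m))"
  obtains b p where "p permutes {n..<n + m}" "f = flip_and_permute n m (b, p)"
proof -
  have ext: "f \<in> extensional {..<n + m}" and bij: "bij_betw f {..<n + m} {..<n + m}"
    and adj: "\<And>x y. x < n + m \<Longrightarrow> y < n + m \<Longrightarrow>
      (f x < n \<and> f y < n \<and> (f y = Suc (f x) \<or> f x = Suc (f y))) \<longleftrightarrow>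
      (x < n \<and> y < n \<and> (y = Suc x \<or> x = Suc y))"
    using f by (auto simp: carrier_graph_Aut[OF is_graph_path_plus_isolated]
        edge_path_plus_isolated_iff)
  have inj: "inj_on f {..<n + m}" using bij by (simp add: bij_betw_def)
  have surj: "\<exists>x<n + m. f x = y" if "y < n + m" for y
    using bij that by (metis bij_betw_imp_surj_on imageE lessThan_iff)
  have neighbour: "\<exists>y<n. y = Suc x \<or> x = Suc y" if "x < n" for x
  proof (cases x)
    case 0
    with n show ?thesis by (intro exI[of _ 1]) simp
  next
    case (Suc y)
    with that show ?thesis by (intro exI[of _ y]) simp
  qed
  have path_iff: "f x < n \<longleftrightarrow> x < n" if x: "x < n + m" for x
  proof
    assume "x < n"
    then obtain y where "y < n" "y = Suc x \<or> x = Suc y" using neighbour by blast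
    then show "f x < n" using adj[of x y] x \<open>x < n\<close> by simp
  next
    assume "f x < n"
    then obtain z where z: "z < n" "z = Suc (f x) \<or> f x = Suc z" using neighbour by blast
    moreover obtain y where "y < n + m" "f y = z" using surj[of z] z(1) by auto
    ultimately show "x < n" using adj[of x y] x \<open>f x < n\<close> by simp
  qed
  have step: "f (Suc i) = Suc (f i) \<or> f i = Suc (f (Suc i))" if "Suc i < n" for i
    using adj[of i "Suc i"] that by simp
  have f0: "f 0 = 0 \<or> f 0 = n - 1"
  proof (rule ccontr)
    assume "\<not> ?thesis"
    then have j: "0 < f 0" "Suc (f 0) < n" using path_iff[of 0] n by auto
    \<comment> \<open>Both neighbours of an interior vertex would come from the only neighbour of \<open>0\<close>.\<close>
    then have "f 0 - 1 < n + m" "Suc (f 0) < n + m" by linarith+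
    then obtain u v where u: "u < n + m" "f u = f 0 - 1" and v: "v < n + m" "f v = Suc (f 0)"
      using surj by meson
    have "u = 1" using adj[of 0 u] u j n by auto
    moreover have "v = 1" using adj[of 0 v] v j n by auto
    ultimately show False using u v by simp
  qed
  define b where "b \<longleftrightarrow> f 0 = n - 1"
  have on_path: "f i = (if b then n - 1 - i else i)" if i: "i < n" for i
  proof (cases b)
    case False
    have "f i = i"
    proof (rule path_walk_from_0[of f n])
      show "inj_on f {..<n}" using inj by (rule inj_on_subset) auto
      show "f 0 = 0" using False f0 by (simp add: b_def)
    qed (use step i in auto)
    with False show ?thesis by simp
  next
    case True
    have lt: "f x < n" if "x < n" for x using path_iff[of x] that by simp
    have "(\<lambda>i. n - 1 - f i) i = i"
    proof (rule path_walk_from_0[of _ n])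
      show "inj_on (\<lambda>i. n - 1 - f i) {..<n}"
      proof (rule inj_onI)
        fix x y assume xy: "x \<in> {..<n}" "y \<in> {..<n}" "n - 1 - f x = n - 1 - f y"
        then have "f x = f y" using lt[of x] lt[of y] by auto
        then show "x = y" using inj xy by (auto simp: inj_on_def)
      qed
      show "n - 1 - f 0 = 0" using True by (simp add: b_def)
      show "n - 1 - f (Suc j) = Suc (n - 1 - f j) \<or> n - 1 - f j = Suc (n - 1 - f (Suc j))"
        if "Suc j < n" for j
        using step[OF that] lt[of j] lt[of "Suc j"] that by auto
    qed (use i in simp)
    with True lt[OF i] show ?thesis by simp
  qed
  define p where "p = (\<lambda>x. if x \<in> {n..<n + m} then f x else x)"
  have "p permutes {n..<n + m}"
  proof (rule bij_imp_permutes)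
    have "inj_on p {n..<n + m}" using inj by (auto simp: inj_on_def p_def)
    moreover have "p ` {n..<n + m} \<subseteq> {n..<n + m}"
    proof (intro image_subsetI)
      fix x assume x: "x \<in> {n..<n + m}"
      then have "f x < n + m" using bij by (auto dest: bij_betwE)
      with x path_iff[of x] show "p x \<in> {n..<n + m}" by (auto simp: p_def)
    qed
    ultimately show "bij_betw p {n..<n + m} {n..<n + m}"
      by (simp add: bij_betw_def endo_inj_surj)
  qed (auto simp: p_def)
  moreover have "f = flip_and_permute n m (b, p)"
    by (rule extensionalityI[OF ext]) (auto simp: flip_and_permute_def on_path p_def)
  ultimately show ?thesis by (rule that)
qed

lemma inj_on_flip_and_permute:
  assumes n: "2 \<le> n"
  shows "inj_on (flip_and_permute n m) (UNIV \<times> {p. p permutes {n..<n + m}})"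
proof (rule inj_onI, clarify)
  fix b p c q
  assume p: "p permutes {n..<n + m}" and q: "q permutes {n..<n + m}"
    and eq: "flip_and_permute n m (b, p) = flip_and_permute n m (c, q)"
  \<comment> \<open>The image of \<open>0\<close> reveals whether the path is reversed, since its ends are distinct.\<close>
  have "b = c"
    using fun_cong[OF eq, of 0] n by (auto simp: flip_and_permute_def split: if_splits)
  moreover have "p x = q x" for x
  proof (cases "x \<in> {n..<n + m}")
    case True
    then show ?thesis using fun_cong[OF eq, of x] by (simp add: flip_and_permute_def)
  next
    case False
    then show ?thesis using permutes_not_in[OF p] permutes_not_in[OF q] by simp
  qed
  ultimately show "b = c \<and> p = q" by auto
qed

lemma order_graph_Aut_path_plus_isolated:
  assumes "2 \<le> n"
  shows "order (graph_Aut (path_plus_isolated n m)) = 2 * fact m"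
proof -
  let ?P = "(UNIV :: bool set) \<times> {p. p permutes {n..<n + m}}"
  have "carrier (graph_Aut (path_plus_isolated n m)) = flip_and_permute n m ` ?P"
  proof (intro equalityI subsetI)
    fix f assume "f \<in> carrier (graph_Aut (path_plus_isolated n m))"
    then show "f \<in> flip_and_permute n m ` ?P"
      by (rule graph_Aut_path_plus_isolated_cases[OF assms]) blast
  qed (auto intro: flip_and_permute_in_Aut)
  then have "order (graph_Aut (path_plus_isolated n m)) = card ?P"
    by (simp add: order_def card_image[OF inj_on_flip_and_permute[OF assms]])
  also have "\<dots> = 2 * fact m"
    by (simp add: card_cartesian_product card_permutations[of "{n..<n + m}" m])
  finally show ?thesis .
qed

section \<open>Realising a given ratio\<close>

lemma pos_rat_obtain_nat_fraction:
  fixes r :: rat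
  assumes "0 < r"
  obtains a b :: nat where "0 < a" "0 < b" "r = of_nat a / of_nat b"
proof -
  obtain p q where pq: "quotient_of r = (p, q)" by (cases "quotient_of r")
  then have q: "0 < q" and r: "r = of_int p / of_int q"
    by (auto intro: quotient_of_denom_pos quotient_of_div)
  with assms have p: "0 < p" by (simp add: zero_less_divide_iff)
  show ?thesis
    using p q r by (intro that[of "nat p" "nat q"]) simp_all
qed

theorem theorem1p5:
  fixes r :: rat
  assumes "0 < r"
  shows "(\<exists>\<Gamma> :: nat graph. is_graph \<Gamma> \<and> finite (verts \<Gamma>) \<and>
            r = of_nat (order (graph_Aut \<Gamma>)) / of_nat (card (verts \<Gamma>))) \<and>
         (\<exists>\<Gamma> :: nat graph. is_graph \<Gamma> \<and> finite (verts \<Gamma>) \<and>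
            r = of_nat (order (graph_Aut \<Gamma>)) / of_nat (card (verts \<Gamma>) + card (edges \<Gamma>)))"
proof -
  obtain a b :: nat where a: "0 < a" and b: "0 < b" and r: "r = of_nat a / of_nat b"
    using pos_rat_obtain_nat_fraction[OF assms] .
  \<comment> \<open>An odd number such that \<open>a\<close> divides even \<open>(m - 1)!\<close>: then \<open>m! / a\<close> is a multiple
    of \<open>m\<close>, hence at least \<open>m\<close>, with no estimate of factorials.\<close>
  define m where "m = 2 * a + 3"
  have "a dvd fact (m - 1)" using a by (intro dvd_fact) (auto simp: m_def)
  then obtain d where d: "fact (m - 1) = a * d" by (elim dvdE)
  have "0 < d" using d by (cases "d = 0") auto
  \<comment> \<open>\<open>2 * K\<close> is the required value of \<open>|V|\<close>, respectively \<open>|V| + |E|\<close>.\<close>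
  define K where "K = m * d * b"
  have "m * 1 * 1 \<le> m * d * b" using \<open>0 < d\<close> b by (intro mult_le_mono) auto
  then have K: "m \<le> K" by (simp add: K_def)
  have "0 < m" by (simp add: m_def)
  from fact_reduce[OF this, where 'a = nat] have "fact m = m * (a * d)"
    by (simp only: d of_nat_id)
  then have "a * (2 * K) = 2 * fact m * b" by (simp add: K_def)
  then have "rat_of_nat a * of_nat (2 * K) = of_nat (2 * fact m) * of_nat b"
    by (metis of_nat_mult)
  moreover have "0 < rat_of_nat (2 * K)" "0 < rat_of_nat b"
    using K b by (simp_all add: m_def)
  ultimately have ratio: "r = of_nat (2 * fact m) / of_nat (2 * K)"
    unfolding r by (simp only: frac_eq_eq less_imp_neq[symmetric] not_False_eq_True)

  define n\<^sub>1 where "n\<^sub>1 = 2 * K - m"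
  define n\<^sub>2 where "n\<^sub>2 = K - (a + 1)"
  have "2 \<le> n\<^sub>1" "2 \<le> n\<^sub>2" using K a by (simp_all add: n\<^sub>1_def n\<^sub>2_def m_def)
  note Aut = this[THEN order_graph_Aut_path_plus_isolated, of m]
  have V: "card (verts (path_plus_isolated n\<^sub>1 m)) = 2 * K"
    using K by (simp add: n\<^sub>1_def)
  have VE: "card (verts (path_plus_isolated n\<^sub>2 m)) +
      card (edges (path_plus_isolated n\<^sub>2 m)) = 2 * K"
    using K by (simp add: card_edges_path_plus_isolated n\<^sub>2_def m_def)
  have r\<^sub>1: "r = of_nat (order (graph_Aut (path_plus_isolated n\<^sub>1 m))) /
      of_nat (card (verts (path_plus_isolated n\<^sub>1 m)))"
    unfolding Aut(1) V by (rule ratio)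
  have r\<^sub>2: "r = of_nat (order (graph_Aut (path_plus_isolated n\<^sub>2 m))) /
      of_nat (card (verts (path_plus_isolated n\<^sub>2 m)) + card (edges (path_plus_isolated n\<^sub>2 m)))"
    unfolding Aut(2) VE by (rule ratio)
  have fin: "finite (verts (path_plus_isolated k m))" for k by simp
  show ?thesis
    by (rule conjI[OF exI[of _ "path_plus_isolated n\<^sub>1 m"] exI[of _ "path_plus_isolated n\<^sub>2 m"]])
      (intro conjI is_graph_path_plus_isolated fin r\<^sub>1 r\<^sub>2)+
qed

end
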